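(* For every integer $n \ge 1$, the $n$-dimensional hypercube $Q_n$ satisfies \[b_{\rm g}(Q_n) = \begin{cases} 2, & n \in \{1,2\},\\ \left\lceil \frac{n+1}{2}\right\rceil + 1, & \text{otherwise},\end{cases}\qquad\text{and}\qquad b_{\rm g}'(Q_n) = \left\lceil \frac{n}{2}\right\rceil + 1.\]
   Context: $Q_n$ is the graph with vertex set $\{0,1\}^n$ in which two vertices are adjacent iff they differ in exactly one coordinate. The burning game on a finite simple graph $G$ is played by two players, Burner and Staller. Each vertex is either burned or unburned, and once burned it stays burned. In round 1 the starting player chooses one unburned vertex and burns it (selection phase only). Each round $t \ge 2$ consists of a spreading phase, in which every unburned vertex with a burned neighbor becomes burned, followed, if unburned vertices remain, by a selection phase in which the player whose turn it is burns one unburned vertex; the two players make the selections alternately. The game ends in the first round in which all vertices are burned (this may happen right after a spreading phase), and its length is the number of that round. Burner wants to minimize the length and Staller to maximize it. $b_{\rm g}(G)$ is the length under optimal play when Burner makes the first selection, and $b_{\rm g}'(G)$ is the length under optimal play when Staller makes the first selection. *)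

theory Defs
  imports Complex_Main "Graph_Theory.Pair_Digraph"
begin

text \<open>
  Finite simple graphs are the members of the locale \<^locale>\<open>pair_graph\<close> (finite, loopless,
  symmetric): an undirected edge is the pair of opposite arcs between its ends.
\<close>

definition hypercube :: "nat \<Rightarrow> bool list pair_pre_digraph" where
  "hypercube n =
     \<lparr> pverts = {xs. length xs = n},
       parcs = {(xs, ys). length xs = n \<and> length ys = n \<and>
                          card {i. i < n \<and> xs ! i \<noteq> ys ! i} = 1} \<rparr>"

lemma pair_graph_hypercube: "pair_graph (hypercube n)"
proof
  show "finite (pverts (hypercube n))"
    using finite_lists_length_eq[of "UNIV :: bool set" n] by (simp add: hypercube_def)
  have "parcs (hypercube n) \<subseteq> pverts (hypercube n) \<times> pverts (hypercube n)"
    by (auto simp: hypercube_def)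
  with \<open>finite (pverts (hypercube n))\<close> show "finite (parcs (hypercube n))"
    by (meson finite_SigmaI finite_subset)
  have "{i. i < n \<and> xs ! i \<noteq> ys ! i} = {i. i < n \<and> ys ! i \<noteq> xs ! i}" for xs ys :: "bool list"
    by metis
  then have "(ys, xs) \<in> parcs (hypercube n)" if "(xs, ys) \<in> parcs (hypercube n)" for xs ys
    using that by (simp only: hypercube_def pair_pre_digraph.simps mem_Collect_eq prod.case)
  then have "sym (parcs (hypercube n))"
    by (rule symI)
  then show "symmetric (hypercube n)"
    by (simp add: symmetric_def arcs_ends_def arc_to_ends_def)
  show "fst e \<in> pverts (hypercube n)" "snd e \<in> pverts (hypercube n)" "fst e \<noteq> snd e"
    if "e \<in> parcs (hypercube n)" for e
    using that by (cases e, force simp: hypercube_def)+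
qed

datatype player = Burner | Staller

fun opponent :: "player \<Rightarrow> player" where
  "opponent Burner = Staller"
| "opponent Staller = Burner"

definition spread :: "'a pair_pre_digraph \<Rightarrow> 'a set \<Rightarrow> 'a set" where
  "spread G B = B \<union> {v \<in> pverts G. \<exists>u\<in>B. (u, v) \<in> parcs G}"

text \<open>
  \<open>rounds_left G p B\<close> is the number of rounds still to be played, under optimal play, when \<open>B\<close> is
  the set of vertices burned so far and the next selection is made by \<open>p\<close>. Each unfolding with
  an unburned vertex is one round: the spreading phase, then, if unburned vertices remain, the
  selection by \<open>p\<close>. The value for an infinite graph is arbitrary.
\<close>

function rounds_left :: "'a pair_pre_digraph \<Rightarrow> player \<Rightarrow> 'a set \<Rightarrow> nat" where
  "rounds_left G p B =
     (if infinite (pverts G) \<or> pverts G \<subseteq> B then 0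
      else if pverts G \<subseteq> spread G B then 1
      else 1 + (case p of
          Burner \<Rightarrow> Min ((\<lambda>v. rounds_left G (opponent p) (insert v (spread G B)))
                          ` (pverts G - spread G B))
        | Staller \<Rightarrow> Max ((\<lambda>v. rounds_left G (opponent p) (insert v (spread G B)))
                          ` (pverts G - spread G B))))"
  by pat_completeness auto

termination
proof (relation "measure (\<lambda>(G, p, B). card (pverts G - B))", goal_cases)
  case 1
  show ?case by simp
next
  case (2 G p B v)
  then have "pverts G - insert v (spread G B) \<subset> pverts G - B"
    by (auto simp: spread_def)
  with 2 have "card (pverts G - insert v (spread G B)) < card (pverts G - B)"
    by (intro psubset_card_mono) auto
  then show ?case
    by (simp only: in_measure prod.case)
next
  case (3 G p B v)
  then have "pverts G - insert v (spread G B) \<subset> pverts G - B"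
    by (auto simp: spread_def)
  with 3 have "card (pverts G - insert v (spread G B)) < card (pverts G - B)"
    by (intro psubset_card_mono) auto
  then show ?case
    by (simp only: in_measure prod.case)
qed

declare rounds_left.simps [simp del]

text \<open>
  Nothing is burned at the start, so the spreading phase of round 1 is vacuous and the round
  amounts to the selection phase alone.
\<close>

definition burning_game_number :: "'a pair_pre_digraph \<Rightarrow> nat" where
  "burning_game_number G = rounds_left G Burner {}"

definition staller_start_burning_game_number :: "'a pair_pre_digraph \<Rightarrow> nat" where
  "staller_start_burning_game_number G = rounds_left G Staller {}"

end

theory Submission
  imports Defs
begin

text \<open>
  Upper bounds: Burner aims at the antipode of the first vertex; the two balls growing around
  antipodal vertices then cover the cube.

  Lower bounds, following Alon's argument for transmission in the cube: identify vertices with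
  sign vectors, so that the distance of \<open>y\<close> to a selected vertex is an affine function of their
  inner product, and round a fractional vector, in the manner of Beck and Spencer, to a vertex
  whose inner product with each selected vertex is small, the tolerance growing with the time of
  selection. Rounding the zero vector shows that no sequence of \<open>\<lceil>n/2\<rceil>\<close> selections burns the cube.
  If \<open>n\<close> is even and Burner starts, Staller gains one more round by answering with a vertex at
  distance 2, since the balls around the first two vertices then overlap so much that a single
  functional keeps \<open>y\<close> away from both.
\<close>

section \<open>Rounding\<close>

text \<open>Gaussian elimination: the last equation, unless trivial on \<open>F\<close>, is solved
  for one unknown \<open>p\<close> and substituted into the others, which leaves \<open>k\<close>
  equations in more than \<open>k\<close> unknowns.\<close>

lemma homogeneous_system_nontrivial:
  fixes b :: "nat \<Rightarrow> 'a \<Rightarrow> real"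
  assumes "finite F" "k < card F"
  shows "\<exists>d. (\<exists>x\<in>F. d x \<noteq> 0) \<and> (\<forall>i<k. (\<Sum>x\<in>F. b i x * d x) = 0)"
  using assms
proof (induction k arbitrary: F b)
  case 0
  then have "F \<noteq> {}" by auto
  then show ?case by (intro exI[of _ "\<lambda>_. 1"]) auto
next
  case (Suc k)
  show ?case
  proof (cases "\<forall>x\<in>F. b k x = 0")
    case True
    obtain d where "\<exists>x\<in>F. d x \<noteq> 0" "\<forall>i<k. (\<Sum>x\<in>F. b i x * d x) = 0"
      using Suc.IH[of F b] Suc.prems by auto
    with True show ?thesis by (intro exI[of _ d]) (auto simp: less_Suc_eq)
  next
    case False
    then obtain p where p: "p \<in> F" "b k p \<noteq> 0" by auto
    define F' where "F' = F - {p}"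
    have F': "finite F'" "k < card F'" "p \<notin> F'" "F = insert p F'"
      using Suc.prems p by (auto simp: F'_def)
    obtain d where d: "\<exists>x\<in>F'. d x \<noteq> 0"
      "\<And>i. i < k \<Longrightarrow> (\<Sum>x\<in>F'. (b i x - b i p * b k x / b k p) * d x) = 0"
      using Suc.IH[of F' "\<lambda>i x. b i x - b i p * b k x / b k p"] F' by auto
    define S where "S = (\<Sum>x\<in>F'. b k x * d x)"
    define e where "e = d(p := - S / b k p)"
    have e: "(\<Sum>x\<in>F. b i x * e x) = (\<Sum>x\<in>F'. b i x * d x) - b i p * S / b k p" for i
    proof -
      have "(\<Sum>x\<in>F'. b i x * e x) = (\<Sum>x\<in>F'. b i x * d x)"
        using F' by (intro sum.cong) (auto simp: e_def)
      then show ?thesis using F' by (simp add: e_def)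
    qed
    have "(\<Sum>x\<in>F. b i x * e x) = 0" if "i < Suc k" for i
    proof (cases "i = k")
      case True
      then show ?thesis using p by (simp add: e S_def)
    next
      case False
      with that have "i < k" by simp
      then have "0 = (\<Sum>x\<in>F'. b i x * d x - b i p / b k p * (b k x * d x))"
        by (subst d(2)[symmetric]) (auto simp: algebra_simps intro!: sum.cong)
      also have "\<dots> = (\<Sum>x\<in>F. b i x * e x)"
        unfolding e S_def by (simp add: sum_subtractf sum_distrib_left sum_divide_distrib)
      finally show ?thesis by simp
    qed
    moreover have "\<exists>x\<in>F. e x \<noteq> 0" using d(1) F' by (auto simp: e_def)
    ultimately show ?thesis by blast
  qed
qed

lemma move_until_frozen:
  fixes z d :: "'a \<Rightarrow> real"
  assumes "finite F" "\<And>x. x \<in> F \<Longrightarrow> \<bar>z x\<bar> < 1" "\<exists>x\<in>F. d x \<noteq> 0"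
  shows "\<exists>t\<ge>0. (\<forall>x\<in>F. \<bar>z x + t * d x\<bar> \<le> 1) \<and> (\<exists>x\<in>F. \<bar>z x + t * d x\<bar> = 1)"
proof -
  \<comment> \<open>\<open>\<tau> x\<close> is the time at which coordinate \<open>x\<close>, moving
    with velocity \<open>d x\<close>, reaches \<open>sgn (d x)\<close>. At the least of these times
    one coordinate freezes and no other has left the interval.\<close>
  define \<tau> where "\<tau> x = (1 - sgn (d x) * z x) / \<bar>d x\<bar>" for x
  define D where "D = {x\<in>F. d x \<noteq> 0}"
  have D: "finite D" "D \<noteq> {}" using assms by (auto simp: D_def)
  define t where "t = Min (\<tau> ` D)"
  have le: "t \<le> \<tau> x" if "x \<in> D" for x using that D by (simp add: t_def)
  have "t \<in> \<tau> ` D" unfolding t_def using D by (intro Min_in) simp_all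
  then obtain x0 where x0: "x0 \<in> D" "t = \<tau> x0" by (rule imageE)
  have "\<tau> x \<ge> 0" if "x \<in> D" for x
    using that assms(2)[of x] by (auto simp: \<tau>_def D_def sgn_if)
  then have t0: "t \<ge> 0" using x0 by simp
  have "\<bar>z x + t * d x\<bar> \<le> 1" if "x \<in> F" for x
  proof (cases "d x = 0")
    case True
    then show ?thesis using assms(2)[OF that] by simp
  next
    case False
    then have "t * \<bar>d x\<bar> \<le> 1 - sgn (d x) * z x"
      using le[of x] that by (simp add: \<tau>_def D_def field_simps)
    moreover have "t * \<bar>d x\<bar> \<ge> 0" using t0 by simp
    ultimately show ?thesis
      using assms(2)[OF that] False by (cases "d x > 0") (auto simp: sgn_if abs_if split: if_splits)
  qed
  moreover have "\<bar>z x0 + t * d x0\<bar> = 1"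
    using x0 unfolding x0(2) by (auto simp: \<tau>_def D_def sgn_if abs_if field_simps split: if_splits)
  ultimately show ?thesis using t0 x0(1) by (auto simp: D_def)
qed

text \<open>
  With \<open>f\<close> coordinates strictly inside \<open>(-1, 1)\<close>, one moves along a line that keeps the values of
  the first \<open>f - 1\<close> functionals and does not increase that of the next one, until a coordinate
  is frozen. Thus functional \<open>i\<close> can only increase once at most \<open>i\<close> coordinates are left, each
  contributing less than 2.
\<close>

theorem rounding:
  fixes b :: "nat \<Rightarrow> 'a \<Rightarrow> real" and z :: "'a \<Rightarrow> real"
  assumes "finite I" "\<And>x. x \<in> I \<Longrightarrow> \<bar>z x\<bar> \<le> 1"
    and "\<And>i x. i > 0 \<Longrightarrow> x \<in> I \<Longrightarrow> \<bar>b i x\<bar> \<le> 1"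
  shows "\<exists>y. (\<forall>x\<in>I. \<bar>y x\<bar> = 1) \<and> (\<forall>x\<in>I. \<bar>z x\<bar> = 1 \<longrightarrow> y x = z x)
    \<and> (\<Sum>x\<in>I. b 0 x * y x) \<le> (\<Sum>x\<in>I. b 0 x * z x)
    \<and> (\<forall>i>0. (\<Sum>x\<in>I. b i x * y x) < (\<Sum>x\<in>I. b i x * z x) + 2 * real i)"
  using assms(2)
proof (induction "card {x\<in>I. \<bar>z x\<bar> < 1}" arbitrary: z rule: less_induct)
  case less
  define F where "F = {x\<in>I. \<bar>z x\<bar> < 1}"
  have F: "finite F" "F \<subseteq> I" using assms(1) by (auto simp: F_def)
  have frozen: "\<bar>z x\<bar> = 1" if "x \<in> I - F" for x
    using less.prems[of x] that by (auto simp: F_def)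
  show ?case
  proof (cases "F = {}")
    case True
    then show ?thesis using frozen by (intro exI[of _ z]) auto
  next
    case False
    define k where "k = card F - 1"
    have k: "card F = Suc k" using False F by (simp add: k_def card_gt_0_iff)
    obtain d0 where d0: "\<exists>x\<in>F. d0 x \<noteq> 0" "\<forall>i<k. (\<Sum>x\<in>F. b i x * d0 x) = 0"
      using homogeneous_system_nontrivial[OF F(1), of k b] k by auto
    \<comment> \<open>A solution may be negated, so the choice of sign can be spent on functional
      \<open>k\<close>.\<close>
    define s :: real where "s = (if (\<Sum>x\<in>F. b k x * d0 x) \<le> 0 then 1 else -1)"
    define d where "d x = s * d0 x" for x
    have dsum: "(\<Sum>x\<in>F. b i x * d x) = s * (\<Sum>x\<in>F. b i x * d0 x)" for i
      by (simp add: d_def sum_distrib_left mult.left_commute)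
    have d1: "\<exists>x\<in>F. d x \<noteq> 0" using d0(1) by (auto simp: d_def s_def)
    have d2: "(\<Sum>x\<in>F. b i x * d x) \<le> 0" if "i \<le> k" for i
      unfolding dsum using d0(2) that by (cases "i = k") (simp_all add: s_def)
    have "\<bar>z x\<bar> < 1" if "x \<in> F" for x using that by (simp add: F_def)
    then have "\<exists>t\<ge>0. (\<forall>x\<in>F. \<bar>z x + t * d x\<bar> \<le> 1) \<and> (\<exists>x\<in>F. \<bar>z x + t * d x\<bar> = 1)"
      by (rule move_until_frozen[OF F(1) _ d1])
    then obtain t where t: "t \<ge> 0" "\<forall>x\<in>F. \<bar>z x + t * d x\<bar> \<le> 1" "\<exists>x\<in>F. \<bar>z x + t * d x\<bar> = 1"
      by (elim exE conjE)
    define z' where "z' x = (if x \<in> F then z x + t * d x else z x)" for x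
    have z': "\<bar>z' x\<bar> \<le> 1" if "x \<in> I" for x
      using t less.prems that by (auto simp: z'_def)
    obtain x0 where x0: "x0 \<in> F" "\<bar>z' x0\<bar> = 1" using t(3) by (auto simp: z'_def)
    have "x \<in> F" if "x \<in> I" "\<bar>z' x\<bar> < 1" for x
      using that frozen[of x] by (auto simp: z'_def split: if_splits)
    moreover have "x0 \<notin> {x\<in>I. \<bar>z' x\<bar> < 1}" using x0(2) by simp
    ultimately have "{x\<in>I. \<bar>z' x\<bar> < 1} \<subset> F" using x0(1) by blast
    then have "card {x\<in>I. \<bar>z' x\<bar> < 1} < card {x\<in>I. \<bar>z x\<bar> < 1}"
      using F(1) psubset_card_mono unfolding F_def by blast
    from less.hyps[OF this z'] obtain y where y: "\<forall>x\<in>I. \<bar>y x\<bar> = 1"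
      "\<forall>x\<in>I. \<bar>z' x\<bar> = 1 \<longrightarrow> y x = z' x"
      "(\<Sum>x\<in>I. b 0 x * y x) \<le> (\<Sum>x\<in>I. b 0 x * z' x)"
      "\<forall>i>0. (\<Sum>x\<in>I. b i x * y x) < (\<Sum>x\<in>I. b i x * z' x) + 2 * real i"
      by blast
    have yz: "y x = z x" if "x \<in> I - F" for x
      using y(2) frozen[OF that] that by (auto simp: z'_def)
    have split: "(\<Sum>x\<in>I. b i x * u x) = (\<Sum>x\<in>F. b i x * u x) + (\<Sum>x\<in>I-F. b i x * z x)"
      if "\<And>x. x \<in> I - F \<Longrightarrow> u x = z x" for i u
      using that sum.subset_diff[OF F(2) assms(1), of "\<lambda>x. b i x * u x"]
      by (simp add: add.commute)
    have desc: "(\<Sum>x\<in>I. b i x * z' x) \<le> (\<Sum>x\<in>I. b i x * z x)" if "i \<le> k" for i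
    proof -
      have "(\<Sum>x\<in>F. b i x * z' x) = (\<Sum>x\<in>F. b i x * z x) + t * (\<Sum>x\<in>F. b i x * d x)"
        by (simp add: z'_def sum_distrib_left sum.distrib[symmetric] algebra_simps)
      then show ?thesis
        using d2[OF that] t(1) split[of z' i] split[of z i]
        by (simp add: z'_def mult_nonneg_nonpos)
    qed
    have "(\<Sum>x\<in>I. b i x * y x) < (\<Sum>x\<in>I. b i x * z x) + 2 * real i" if "i > 0" for i
    proof (cases "i \<le> k")
      case True
      then show ?thesis using y(4)[rule_format, OF that] desc[OF True] by linarith
    next
      \<comment> \<open>Here \<open>card F \<le> i\<close>. The comparison bypasses
        \<open>z'\<close>: from \<open>z\<close> to \<open>y\<close> only coordinates in
        \<open>F\<close> move, each changing the sum by less than 2.\<close>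
      case False
      have lt: "b i x * y x < b i x * z x + 2" if "x \<in> F" for x
      proof -
        have x: "\<bar>z x\<bar> < 1" "\<bar>y x\<bar> = 1" "\<bar>b i x\<bar> \<le> 1"
          using that F(2) y(1) assms(3)[OF \<open>i > 0\<close>] by (auto simp: F_def)
        have "b i x * (y x - z x) \<le> \<bar>b i x\<bar> * \<bar>y x - z x\<bar>"
          using abs_ge_self[of "b i x * (y x - z x)"] by (simp only: abs_mult)
        also have "\<dots> \<le> 1 * \<bar>y x - z x\<bar>" using x(3) by (intro mult_right_mono) simp_all
        also have "\<dots> < 2" using x(1,2) abs_triangle_ineq4[of "y x" "z x"] by simp
        finally have "b i x * (y x - z x) < 2" .
        then show ?thesis by (simp add: algebra_simps)
      qed
      have "(\<Sum>x\<in>F. b i x * y x) < (\<Sum>x\<in>F. b i x * z x + 2)"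
        using lt F(1) \<open>F \<noteq> {}\<close> by (intro sum_strict_mono) auto
      also have "\<dots> = (\<Sum>x\<in>F. b i x * z x) + 2 * real (card F)"
        by (simp add: sum.distrib)
      also have "\<dots> \<le> (\<Sum>x\<in>F. b i x * z x) + 2 * real i" using False k by simp
      finally show ?thesis using split[of y i] split[of z i] yz by simp
    qed
    \<comment> \<open>\<open>0 \<le> k\<close> as long as some coordinate is loose, so functional 0
      never increases and carries no error term.\<close>
    moreover have "(\<Sum>x\<in>I. b 0 x * y x) \<le> (\<Sum>x\<in>I. b 0 x * z x)"
      using y(3) desc[of 0] by simp
    moreover have "\<forall>x\<in>I. \<bar>z x\<bar> = 1 \<longrightarrow> y x = z x"
      using yz by (auto simp: F_def)
    ultimately show ?thesis using y(1) by blast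
  qed
qed

section \<open>Hamming distance and signs\<close>

text \<open>The set is the one that defines the arcs of \<open>hypercube\<close>, so distance 1 is
  adjacency. No lengths are imposed: symmetry, the triangle inequality and \<open>spin_sum\<close>
  hold for arbitrary lists.\<close>

definition hdist :: "nat \<Rightarrow> bool list \<Rightarrow> bool list \<Rightarrow> nat" where
  "hdist n xs ys = card {i. i < n \<and> xs ! i \<noteq> ys ! i}"

definition spin :: "bool \<Rightarrow> real" where
  "spin p = (if p then 1 else -1)"

lemma abs_spin [simp]: "\<bar>spin p\<bar> = 1"
  by (simp add: spin_def)

lemma hdist_commute: "hdist n xs ys = hdist n ys xs"
  unfolding hdist_def by metis

lemma hdist_triangle: "hdist n xs zs \<le> hdist n xs ys + hdist n ys zs"
proof -
  have "hdist n xs zs \<le> card ({i. i < n \<and> xs ! i \<noteq> ys ! i} \<union> {i. i < n \<and> ys ! i \<noteq> zs ! i})"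
    unfolding hdist_def by (intro card_mono) auto
  also have "\<dots> \<le> hdist n xs ys + hdist n ys zs"
    unfolding hdist_def by (rule card_Un_le)
  finally show ?thesis .
qed

lemma hdist_self [simp]: "hdist n xs xs = 0"
  by (simp add: hdist_def)

lemma hdist_eq_0_iff:
  assumes "length xs = n" "length ys = n"
  shows "hdist n xs ys = 0 \<longleftrightarrow> xs = ys"
  using assms by (auto simp: hdist_def list_eq_iff_nth_eq)

text \<open>Agreeing coordinates contribute 1, differing ones -1. Upper bounds on inner products,
  which rounding provides, thus become lower bounds on distances.\<close>

lemma spin_sum: "(\<Sum>i<n. spin (xs ! i) * spin (ys ! i)) = real n - 2 * real (hdist n xs ys)"
proof -
  have "(\<Sum>i<n. spin (xs ! i) * spin (ys ! i)) = (\<Sum>i<n. 1 - 2 * of_bool (xs ! i \<noteq> ys ! i))"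
    by (intro sum.cong) (auto simp: spin_def)
  also have "\<dots> = real n - 2 * real (hdist n xs ys)"
    by (simp add: sum_subtractf sum_distrib_left[symmetric] hdist_def Int_def flip: sum.inter_filter)
  finally show ?thesis .
qed

lemma hdist_antipode:
  assumes "length xs = n"
  shows "hdist n xs ys + hdist n (map Not xs) ys = n"
proof -
  have "{i. i < n \<and> map Not xs ! i \<noteq> ys ! i} = {i. i < n \<and> \<not> xs ! i \<noteq> ys ! i}"
    using assms by auto
  then have "hdist n xs ys + hdist n (map Not xs) ys
      = card ({i. i < n \<and> xs ! i \<noteq> ys ! i} \<union> {i. i < n \<and> \<not> xs ! i \<noteq> ys ! i})"
    unfolding hdist_def by (subst card_Un_disjoint) auto
  also have "{i. i < n \<and> xs ! i \<noteq> ys ! i} \<union> {i. i < n \<and> \<not> xs ! i \<noteq> ys ! i} = {..<n}"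
    by auto
  finally show ?thesis by simp
qed

lemma hdist_flip:
  assumes "length xs = n" "i < n"
  shows "hdist n xs (xs[i := \<not> xs ! i]) = 1"
proof -
  have "{j. j < n \<and> xs ! j \<noteq> xs[i := \<not> xs ! i] ! j} = {i}"
    using assms by (auto simp: nth_list_update)
  then show ?thesis by (simp add: hdist_def)
qed

lemma hdist_step:
  assumes "length xs = n" "hdist n xs ys = Suc r"
  shows "\<exists>us. length us = n \<and> hdist n xs us = 1 \<and> hdist n us ys = r"
proof -
  let ?D = "{i. i < n \<and> xs ! i \<noteq> ys ! i}"
  have "?D \<noteq> {}" using assms(2) unfolding hdist_def by (metis card.empty nat.distinct(1))
  then obtain i where i: "i < n" "xs ! i \<noteq> ys ! i" by auto
  have "{j. j < n \<and> xs[i := \<not> xs ! i] ! j \<noteq> ys ! j} = ?D - {i}"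
    using assms(1) i by (auto simp: nth_list_update)
  then have "hdist n (xs[i := \<not> xs ! i]) ys = r"
    using assms(2) i by (simp add: hdist_def)
  then show ?thesis
    using assms(1) hdist_flip[OF assms(1) i(1)] by (intro exI[of _ "xs[i := \<not> xs ! i]"]) simp
qed

lemma ex_hdist_2:
  assumes "length xs = n" "n \<ge> 2"
  shows "\<exists>ys. length ys = n \<and> hdist n xs ys = 2"
proof -
  have "{j. j < n \<and> xs ! j \<noteq> xs[0 := \<not> xs ! 0, 1 := \<not> xs ! 1] ! j} = {0, 1}"
    using assms by (auto simp: nth_list_update)
  then have "hdist n xs (xs[0 := \<not> xs ! 0, 1 := \<not> xs ! 1]) = 2" by (simp add: hdist_def)
  with assms(1) show ?thesis by (metis length_list_update)
qed

section \<open>Vertices outside prescribed balls\<close>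

lemma rounding_cube:
  fixes b :: "nat \<Rightarrow> nat \<Rightarrow> real"
  assumes "\<And>i. i < n \<Longrightarrow> \<bar>z i\<bar> \<le> 1" "\<And>j i. j > 0 \<Longrightarrow> i < n \<Longrightarrow> \<bar>b j i\<bar> \<le> 1"
  shows "\<exists>ys. length ys = n \<and> (\<Sum>i<n. b 0 i * spin (ys ! i)) \<le> (\<Sum>i<n. b 0 i * z i)
    \<and> (\<forall>j>0. (\<Sum>i<n. b j i * spin (ys ! i)) < (\<Sum>i<n. b j i * z i) + 2 * real j)"
proof -
  obtain y where y: "\<forall>i\<in>{..<n}. \<bar>y i\<bar> = 1"
    "(\<Sum>i<n. b 0 i * y i) \<le> (\<Sum>i<n. b 0 i * z i)"
    "\<forall>j>0. (\<Sum>i<n. b j i * y i) < (\<Sum>i<n. b j i * z i) + 2 * real j"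
    using rounding[of "{..<n}" z b] assms by auto
  define ys where "ys = map (\<lambda>i. y i = 1) [0..<n]"
  have "spin (ys ! i) = y i" if "i < n" for i
    using bspec[OF y(1), of i] that by (simp add: ys_def spin_def abs_if split: if_splits)
  then have "(\<Sum>i<n. b j i * spin (ys ! i)) = (\<Sum>i<n. b j i * y i)" for j by simp
  then show ?thesis using y(2,3) by (intro exI[of _ ys]) (simp add: ys_def)
qed

text \<open>The larger the radius, the smaller the tolerable error, so \<open>a j\<close> gets
  functional \<open>k - 1 - j\<close>. Starting from zero, its inner product with \<open>ys\<close>
  is at most \<open>2 * (k - 1 - j)\<close>, and \<open>2 * k \<le> n + 1\<close> turns this into
  distance above \<open>j\<close>.\<close>

lemma escape_from_balls:
  fixes a :: "nat \<Rightarrow> bool list"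
  assumes "2 * k \<le> n + 1"
  shows "\<exists>ys. length ys = n \<and> (\<forall>j<k. hdist n (a j) ys > j)"
proof -
  obtain ys where ys: "length ys = n" "(\<Sum>i<n. spin (a (k - 1 - 0) ! i) * spin (ys ! i)) \<le> 0"
    "\<And>j. j > 0 \<Longrightarrow> (\<Sum>i<n. spin (a (k - 1 - j) ! i) * spin (ys ! i)) < 2 * real j"
    using rounding_cube[of n "\<lambda>_. 0" "\<lambda>j i. spin (a (k - 1 - j) ! i)"] by auto
  have le: "(\<Sum>i<n. spin (a (k - 1 - j) ! i) * spin (ys ! i)) \<le> 2 * real j" for j
    using ys(2) ys(3)[of j] by (cases "j = 0") auto
  have "hdist n (a j) ys > j" if "j < k" for j
    using le[of "k - 1 - j"] that assms unfolding spin_sum by simp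
  with ys(1) show ?thesis by blast
qed

text \<open>
  The weights 3/4 and 1/4 make a single functional control both distances: if
  \<open>3 d(v,y) + d(w,y) > 4m + 2\<close> and \<open>d(v,w) = 2\<close>, then \<open>y\<close> lies outside both balls around
  \<open>v\<close> and \<open>w\<close>. The starting point \<open>- 2/n\<close> times that functional pushes its value below \<open>-1\<close>
  and costs every other vertex at most 2.
\<close>

lemma escape_from_balls_even:
  fixes a :: "nat \<Rightarrow> bool list"
  assumes "n = 2 * m" "m \<ge> 2" "hdist n v w = 2"
  shows "\<exists>ys. length ys = n \<and> hdist n v ys > m \<and> hdist n w ys > m - 1
    \<and> (\<forall>j<m-1. hdist n (a j) ys > j)"
proof -
  define c where "c i = 3/4 * spin (v ! i) + 1/4 * spin (w ! i)" for i
  define z where "z i = - (2 / real n) * c i" for i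
  \<comment> \<open>Index 0, the one without error, is reserved for the pair \<open>v\<close>,
    \<open>w\<close>; for \<open>j < m - 1\<close> the index of \<open>a j\<close> is
    positive.\<close>
  define b where "b j i = (if j = 0 then c i else spin (a (m - 1 - j) ! i))" for j i
  have n: "n \<ge> 4" using assms by simp
  have c: "\<bar>c i\<bar> \<le> 1" for i by (simp add: c_def spin_def)
  have zabs: "\<bar>z i\<bar> \<le> 2 / real n" for i
    using c[of i] mult_left_mono[of "\<bar>c i\<bar>" 1 "2 / real n"] by (simp add: z_def abs_mult)
  have "2 / real n \<le> 1" using n by simp
  then have "\<bar>z i\<bar> \<le> 1" for i using zabs[of i] by simp
  moreover have "\<bar>b j i\<bar> \<le> 1" for j i using c by (simp add: b_def)
  ultimately obtain ys where ys: "length ys = n"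
    "(\<Sum>i<n. b 0 i * spin (ys ! i)) \<le> (\<Sum>i<n. b 0 i * z i)"
    "\<And>j. j > 0 \<Longrightarrow> (\<Sum>i<n. b j i * spin (ys ! i)) < (\<Sum>i<n. b j i * z i) + 2 * real j"
    using rounding_cube[of n z b] by blast
  \<comment> \<open>The square of \<open>c i\<close> is 1 where \<open>v\<close> and
    \<open>w\<close> agree and 1/4 at the two places where they differ.\<close>
  have "(\<Sum>i<n. c i * c i) = (\<Sum>i<n. 10/16 + 6/16 * (spin (v ! i) * spin (w ! i)))"
    by (intro sum.cong) (auto simp: c_def spin_def)
  also have "\<dots> = 10/16 * real n + 6/16 * (\<Sum>i<n. spin (v ! i) * spin (w ! i))"
    by (simp add: sum.distrib sum_distrib_left)
  also have "\<dots> = real n - 3/2" unfolding spin_sum using assms(3) by (simp add: field_simps)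
  finally have cc: "(\<Sum>i<n. c i * c i) = real n - 3/2" .
  have "(\<Sum>i<n. c i * z i) = - (2 / real n) * (\<Sum>i<n. c i * c i)"
    unfolding z_def sum_distrib_left by (intro sum.cong) simp_all
  \<comment> \<open>The value is \<open>-2 + 3 / n\<close>, which is below -1 because
    \<open>n \<ge> 4\<close>.\<close>
  also have "\<dots> < -1" unfolding cc using n by (simp add: field_simps)
  finally have cz: "(\<Sum>i<n. c i * z i) < -1" .
  have "(\<Sum>i<n. c i * spin (ys ! i))
      = 3/4 * (\<Sum>i<n. spin (v ! i) * spin (ys ! i)) + 1/4 * (\<Sum>i<n. spin (w ! i) * spin (ys ! i))"
    by (simp add: c_def sum.distrib sum_distrib_left algebra_simps)
  then have "3 * real (hdist n v ys) + real (hdist n w ys) > 2 * real n + 2"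
    using ys(2) cz unfolding b_def spin_sum by (simp only: if_True refl) argo
  then have "3 * hdist n v ys + hdist n w ys > 4 * m + 2" using assms(1) by linarith
  moreover have "hdist n w ys \<le> hdist n v ys + 2" "hdist n v ys \<le> hdist n w ys + 2"
    using hdist_triangle[of n w ys v] hdist_triangle[of n v ys w] assms(3)
    by (simp_all add: hdist_commute)
  \<comment> \<open>Distance at most \<open>m\<close> from \<open>v\<close> allows at most
    \<open>m + 2\<close> from \<open>w\<close>, and distance at most \<open>m - 1\<close> from
    \<open>w\<close> allows at most \<open>m + 1\<close> from \<open>v\<close>; either way the
    weighted sum is at most \<open>4 * m + 2\<close>.\<close>
  ultimately have vw: "hdist n v ys > m" "hdist n w ys > m - 1" using assms(2) by linarith+
  have "hdist n (a j) ys > j" if j: "j < m - 1" for j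
  proof -
    define i where "i = m - 1 - j"
    have i: "i > 0" "m - 1 - i = j" using j by (auto simp: i_def)
    have "(\<Sum>l<n. b i l * z l) \<le> (\<Sum>l<n. 2 / real n)"
    proof (rule sum_mono)
      fix l
      have "\<bar>b i l * z l\<bar> \<le> 2 / real n" using zabs[of l] i by (simp add: b_def abs_mult)
      then show "b i l * z l \<le> 2 / real n" by linarith
    qed
    then have "(\<Sum>l<n. spin (a j ! l) * spin (ys ! l)) < 2 + 2 * real i"
      using ys(3)[OF i(1)] n i by (simp add: b_def)
    then show ?thesis unfolding spin_sum i_def using assms(1) j by simp
  qed
  with ys(1) vw show ?thesis by blast
qed

section \<open>Spreading in the hypercube\<close>

abbreviation cube :: "nat \<Rightarrow> bool list set" where
  "cube n \<equiv> {xs. length xs = n}"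

lemma pverts_hypercube [simp]: "pverts (hypercube n) = cube n"
  by (simp add: hypercube_def)

lemma finite_cube [simp]: "finite (cube n)"
  using finite_lists_length_eq[of "UNIV :: bool set" n] by simp

lemma spread_hypercube:
  "spread (hypercube n) B = B \<union> {y \<in> cube n. \<exists>x\<in>B. length x = n \<and> hdist n x y = 1}"
  by (auto simp: spread_def hypercube_def hdist_def)

lemma spread_empty [simp]: "spread G {} = {}"
  by (simp add: spread_def)

lemma subset_spread: "B \<subseteq> spread G B"
  by (auto simp: spread_def)

text \<open>By the triangle inequality, one spreading phase brings the fire at most one step closer
  to \<open>y\<close>.\<close>

lemma hdist_spread_gt:
  assumes "\<And>x. x \<in> B \<Longrightarrow> hdist n x y > Suc r" "x \<in> spread (hypercube n) B"
  shows "hdist n x y > r"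
proof -
  from assms(2) consider "x \<in> B" | u where "u \<in> B" "hdist n u x = 1"
    by (auto simp: spread_hypercube)
  then show ?thesis
  proof cases
    case 1
    then show ?thesis using assms(1)[of x] by simp
  next
    case (2 u)
    then show ?thesis using assms(1)[of u] hdist_triangle[of n u y x] by simp
  qed
qed

lemma ex_spread_hdist_le:
  assumes "x \<in> B" "length x = n" "hdist n x y \<le> Suc r"
  shows "\<exists>u\<in>spread (hypercube n) B. length u = n \<and> hdist n u y \<le> r"
proof (cases "hdist n x y \<le> r")
  case True
  then show ?thesis using assms by (intro bexI[of _ x]) (simp_all add: spread_hypercube)
next
  case False
  then obtain u where "length u = n" "hdist n x u = 1" "hdist n u y = r"
    using hdist_step[of x n y r] assms by auto
  then show ?thesis using assms by (intro bexI[of _ u]) (auto simp: spread_hypercube)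
qed

section \<open>Bounds on the length of the game\<close>

lemma rounds_left_unfold:
  assumes "finite (pverts G)" "\<not> pverts G \<subseteq> spread G B"
  shows "rounds_left G p B = Suc (case p of
          Burner \<Rightarrow> Min ((\<lambda>v. rounds_left G (opponent p) (insert v (spread G B)))
                          ` (pverts G - spread G B))
        | Staller \<Rightarrow> Max ((\<lambda>v. rounds_left G (opponent p) (insert v (spread G B)))
                          ` (pverts G - spread G B)))"
  using assms subset_spread[of B G] by (subst rounds_left.simps) auto

lemma rounds_left_le_1:
  assumes "pverts G \<subseteq> spread G B"
  shows "rounds_left G p B \<le> 1"
  using assms by (subst rounds_left.simps) auto

lemma rounds_left_Burner_le:
  assumes "finite (pverts G)" "u \<in> pverts G - spread G B"
    and "rounds_left G Staller (insert u (spread G B)) \<le> r"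
  shows "rounds_left G Burner B \<le> Suc r"
proof -
  have "\<not> pverts G \<subseteq> spread G B" using assms(2) by blast
  moreover have "Min ((\<lambda>v. rounds_left G Staller (insert v (spread G B))) ` (pverts G - spread G B)) \<le> r"
    using assms by (intro Min.coboundedI[THEN order.trans]) auto
  ultimately show ?thesis using assms(1) by (simp add: rounds_left_unfold)
qed

lemma rounds_left_Staller_le:
  assumes "finite (pverts G)"
    and "\<And>u. u \<in> pverts G - spread G B \<Longrightarrow> rounds_left G Burner (insert u (spread G B)) \<le> r"
  shows "rounds_left G Staller B \<le> Suc r"
proof (cases "pverts G \<subseteq> spread G B")
  case True
  then show ?thesis using rounds_left_le_1[of G B Staller] by simp
next
  case False
  then have "pverts G - spread G B \<noteq> {}" by blast
  with False assms show ?thesis by (auto simp: rounds_left_unfold)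
qed

text \<open>No strategy is involved: if all moves lead to large values, then so do both the minimum
  and the maximum, hence \<open>p\<close> is arbitrary.\<close>

lemma rounds_left_gt:
  assumes "finite (pverts G)" "\<not> pverts G \<subseteq> spread G B"
    and "\<And>u. u \<in> pverts G - spread G B \<Longrightarrow> rounds_left G (opponent p) (insert u (spread G B)) > r"
  shows "rounds_left G p B > Suc r"
proof -
  have "pverts G - spread G B \<noteq> {}" using assms(2) by blast
  moreover from this have "Max ((\<lambda>v. rounds_left G (opponent p) (insert v (spread G B)))
      ` (pverts G - spread G B)) > r"
    using assms by (subst Max_gr_iff) auto
  ultimately show ?thesis using assms by (cases p) (auto simp: rounds_left_unfold)
qed

lemma rounds_left_Staller_gt:
  assumes "finite (pverts G)" "u \<in> pverts G - spread G B"
    and "rounds_left G Burner (insert u (spread G B)) > r"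
  shows "rounds_left G Staller B > Suc r"
proof -
  have "\<not> pverts G \<subseteq> spread G B" using assms(2) by blast
  then show ?thesis using assms by (auto simp: rounds_left_unfold Max_gr_iff)
qed

section \<open>Game length from distances in the cube\<close>

text \<open>Here \<open>a j\<close> stands for the vertex selected, by either player, with
  \<open>j\<close> of the next \<open>r\<close> spreading phases still to come. Fire from it cannot
  reach \<open>y\<close> in that time, nor can fire from \<open>B\<close> in all \<open>r\<close>
  phases.\<close>

lemma hypercube_rounds_left_gt:
  assumes "\<And>a. \<exists>y\<in>cube n. (\<forall>x\<in>B. hdist n x y > r) \<and> (\<forall>j<r. hdist n (a j) y > j)"
  shows "rounds_left (hypercube n) p B > r"
  using assms
proof (induction r arbitrary: B p)
  case 0
  then obtain y where "y \<in> cube n" "\<forall>x\<in>B. hdist n x y > 0" by blast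
  then have "\<not> cube n \<subseteq> B" by force
  then show ?case by (subst rounds_left.simps) auto
next
  case (Suc r)
  from Suc.prems obtain y where "y \<in> cube n" "\<And>x. x \<in> B \<Longrightarrow> hdist n x y > Suc r" by blast
  then have "y \<notin> spread (hypercube n) B"
    using hdist_spread_gt[of B r n y y] by fastforce
  with \<open>y \<in> cube n\<close> have "\<not> pverts (hypercube n) \<subseteq> spread (hypercube n) B" by auto
  moreover have "rounds_left (hypercube n) (opponent p) (insert u (spread (hypercube n) B)) > r" for u
  proof (rule Suc.IH)
    fix a :: "nat \<Rightarrow> bool list"
    \<comment> \<open>The current selection \<open>u\<close> has \<open>r\<close> spreading phases
      ahead of it, so it takes slot \<open>r\<close> of the sequence.\<close>
    obtain y where y: "y \<in> cube n" "\<And>x. x \<in> B \<Longrightarrow> hdist n x y > Suc r"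
      "\<And>j. j < Suc r \<Longrightarrow> hdist n ((a(r := u)) j) y > j"
      using Suc.prems[of "a(r := u)"] by blast
    have "hdist n (a j) y > j" if "j < r" for j using y(3)[of j] that by simp
    moreover have "hdist n u y > r" using y(3)[of r] by simp
    ultimately show "\<exists>y\<in>cube n. (\<forall>x\<in>insert u (spread (hypercube n) B). hdist n x y > r)
        \<and> (\<forall>j<r. hdist n (a j) y > j)"
      using y(1) hdist_spread_gt[OF y(2)] by blast
  qed
  ultimately show ?case by (intro rounds_left_gt) simp_all
qed

text \<open>Spreading alone burns the cube in \<open>r\<close> rounds, and further selections do no
  harm.\<close>

lemma hypercube_rounds_left_le:
  assumes "\<And>y. y \<in> cube n \<Longrightarrow> \<exists>x\<in>B. length x = n \<and> hdist n x y \<le> r"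
  shows "rounds_left (hypercube n) p B \<le> r"
  using assms
proof (induction r arbitrary: B p)
  case 0
  have "cube n \<subseteq> B"
  proof
    fix y assume "y \<in> cube n"
    with 0 obtain x where "x \<in> B" "length x = n" "hdist n x y = 0" by blast
    with \<open>y \<in> cube n\<close> show "y \<in> B" using hdist_eq_0_iff[of x n y] by simp
  qed
  then show ?case by (subst rounds_left.simps) simp
next
  case (Suc r)
  let ?S = "spread (hypercube n) B"
  have le: "rounds_left (hypercube n) q (insert u ?S) \<le> r" for q u
    using Suc.prems ex_spread_hdist_le[of _ B n _ r] by (intro Suc.IH) blast
  show ?case
  proof (cases p)
    case Staller
    then show ?thesis using le by (auto intro: rounds_left_Staller_le)
  next
    case Burner
    show ?thesis
    proof (cases "cube n \<subseteq> ?S")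
      case True
      then show ?thesis using rounds_left_le_1[of "hypercube n" B p] by simp
    next
      case False
      then obtain u where "u \<in> cube n - ?S" by blast
      then show ?thesis using Burner le by (auto intro: rounds_left_Burner_le)
    qed
  qed
qed

text \<open>Burner wants to select \<open>u\<close>. If \<open>u\<close> is already burned, he
  selects any unburned \<open>w\<close> instead and loses nothing, as \<open>u\<close> belongs to
  the fire anyway.\<close>

lemma hypercube_Burner_le:
  assumes "u \<in> cube n"
    and "\<And>y. y \<in> cube n \<Longrightarrow>
      \<exists>x\<in>insert u (spread (hypercube n) B). length x = n \<and> hdist n x y \<le> r"
  shows "rounds_left (hypercube n) Burner B \<le> Suc r"
proof (cases "cube n \<subseteq> spread (hypercube n) B")
  case True
  then show ?thesis using rounds_left_le_1[of "hypercube n" B Burner] by simp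
next
  case False
  then obtain w where w: "w \<in> cube n - spread (hypercube n) B" by blast
  define u' where "u' = (if u \<in> spread (hypercube n) B then w else u)"
  have "u' \<in> cube n - spread (hypercube n) B" using w assms(1) by (auto simp: u'_def)
  moreover have "rounds_left (hypercube n) Staller (insert u' (spread (hypercube n) B)) \<le> r"
    by (rule hypercube_rounds_left_le) (use assms(2) in \<open>fastforce simp: u'_def\<close>)
  ultimately show ?thesis by (intro rounds_left_Burner_le) simp_all
qed

section \<open>Upper bounds from the antipode\<close>

text \<open>Distances from \<open>v\<close> and from its antipode add up to \<open>n\<close>, so
  balls of radii \<open>r + 1\<close> and \<open>r\<close> around them cover the cube when
  \<open>n \<le> 2 * r + 2\<close>. The larger radius is due to the spreading phase before Burner
  selects.\<close>

lemma hypercube_antipode_le: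
  assumes "v \<in> B" "length v = n" "n \<le> 2 * r + 2"
  shows "rounds_left (hypercube n) Burner B \<le> Suc r"
proof (rule hypercube_Burner_le)
  show "map Not v \<in> cube n" using assms(2) by simp
  fix y assume "y \<in> cube n"
  show "\<exists>x\<in>insert (map Not v) (spread (hypercube n) B). length x = n \<and> hdist n x y \<le> r"
  proof (cases "hdist n v y \<le> Suc r")
    case True
    then show ?thesis using ex_spread_hdist_le[OF assms(1,2)] by blast
  next
    case False
    then have "hdist n (map Not v) y \<le> r"
      using hdist_antipode[OF assms(2), of y] assms(3) by simp
    then show ?thesis using assms(2) by simp
  qed
qed

text \<open>The fire at \<open>v\<close> spreads twice before Burner selects the antipode, so the
  radii are \<open>r + 2\<close> and \<open>r\<close>, whatever \<open>w\<close> Staller selects in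
  between.\<close>

lemma hypercube_delayed_antipode_le:
  assumes "length v = n" "n \<le> 2 * r + 3"
  shows "rounds_left (hypercube n) Staller {v} \<le> Suc (Suc r)"
proof (rule rounds_left_Staller_le)
  fix w
  let ?B = "insert w (spread (hypercube n) {v})"
  show "rounds_left (hypercube n) Burner ?B \<le> Suc r"
  proof (rule hypercube_Burner_le)
    show "map Not v \<in> cube n" using assms(1) by simp
    fix y assume "y \<in> cube n"
    show "\<exists>x\<in>insert (map Not v) (spread (hypercube n) ?B). length x = n \<and> hdist n x y \<le> r"
    proof (cases "hdist n v y \<le> Suc (Suc r)")
      case True
      then obtain x where "x \<in> spread (hypercube n) {v}" "length x = n" "hdist n x y \<le> Suc r"
        using ex_spread_hdist_le[of v "{v}" n y "Suc r"] assms(1) by blast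
      then show ?thesis using ex_spread_hdist_le[of x ?B n y r] by blast
    next
      case False
      then have "hdist n (map Not v) y \<le> r"
        using hdist_antipode[OF assms(1), of y] assms(2) by simp
      then show ?thesis using assms(1) by simp
    qed
  qed
qed simp

text \<open>After one spreading phase at most the antipode of \<open>v\<close> is unburned, and
  Staller is then forced to burn it.\<close>

lemma hypercube_dim_le_2_Staller_le:
  assumes "length v = n" "n \<le> 2"
  shows "rounds_left (hypercube n) Staller {v} \<le> 1"
  unfolding One_nat_def
proof (rule rounds_left_Staller_le)
  let ?S = "spread (hypercube n) {v}"
  have anti: "y = map Not v" if "y \<in> cube n - ?S" for y
  proof -
    have "hdist n v y \<noteq> 0" "hdist n v y \<noteq> 1"
      using that assms(1) hdist_eq_0_iff[of v n y] by (auto simp: spread_hypercube)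
    then have "hdist n (map Not v) y = 0"
      using hdist_antipode[OF assms(1), of y] assms(2) by linarith
    then show ?thesis using that assms(1) hdist_eq_0_iff[of "map Not v" n y] by simp
  qed
  fix w assume "w \<in> pverts (hypercube n) - ?S"
  then have "cube n \<subseteq> insert w ?S" using anti by (simp only: pverts_hypercube) blast
  then show "rounds_left (hypercube n) Burner (insert w ?S) \<le> 0"
    by (subst rounds_left.simps) simp
qed simp

section \<open>Lower bounds and the values of the game\<close>

lemma hypercube_game_gt_half: "rounds_left (hypercube n) p {} > (n + 1) div 2"
proof (rule hypercube_rounds_left_gt)
  fix a :: "nat \<Rightarrow> bool list"
  show "\<exists>y\<in>cube n. (\<forall>x\<in>{}. hdist n x y > (n + 1) div 2)
      \<and> (\<forall>j<(n + 1) div 2. hdist n (a j) y > j)"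
    using escape_from_balls[of "(n + 1) div 2" n a] by auto
qed

lemma cube_not_empty: "\<not> cube n \<subseteq> {}"
  using length_replicate[of n True] by blast

text \<open>Staller answers \<open>v\<close> with \<open>w\<close> at distance 2. The two selections
  take two rounds, and \<open>escape_from_balls_even\<close> leaves a vertex unburned for
  \<open>m - 1\<close> more.\<close>

lemma hypercube_even_Burner_gt:
  assumes "n = 2 * m" "m \<ge> 2"
  shows "rounds_left (hypercube n) Burner {} > m + 1"
proof -
  have "rounds_left (hypercube n) Staller {v} > Suc (m - 1)" if v: "length v = n" for v
  proof -
    let ?S = "spread (hypercube n) {v}"
    obtain w where w: "length w = n" "hdist n v w = 2" using ex_hdist_2[OF v] assms by auto
    then have "w \<notin> ?S" by (auto simp: spread_hypercube)
    moreover have "rounds_left (hypercube n) Burner (insert w ?S) > m - 1"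
    proof (rule hypercube_rounds_left_gt)
      fix a :: "nat \<Rightarrow> bool list"
      obtain y where y: "length y = n" "hdist n v y > m" "hdist n w y > m - 1"
        "\<forall>j<m-1. hdist n (a j) y > j"
        using escape_from_balls_even[OF assms w(2), of a] by blast
      \<comment> \<open>The fire at \<open>v\<close> has already spread once, so its ball needs
        radius \<open>m\<close> rather than \<open>m - 1\<close>.\<close>
      have "\<forall>x\<in>?S. hdist n x y > m - 1"
        using y(2) assms(2) hdist_spread_gt[of "{v}" "m - 1" n y] by auto
      with y show "\<exists>y\<in>cube n. (\<forall>x\<in>insert w ?S. hdist n x y > m - 1)
          \<and> (\<forall>j<m-1. hdist n (a j) y > j)" by auto
    qed
    ultimately show ?thesis using w by (intro rounds_left_Staller_gt) simp_all
  qed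
  then have "rounds_left (hypercube n) Burner {} > Suc m"
    using assms(2) cube_not_empty by (intro rounds_left_gt) simp_all
  then show ?thesis by simp
qed

lemma hypercube_Burner_start_le:
  assumes "\<And>v. length v = n \<Longrightarrow> rounds_left (hypercube n) Staller {v} \<le> r"
  shows "rounds_left (hypercube n) Burner {} \<le> Suc r"
  by (rule rounds_left_Burner_le[where u = "replicate n True"]) (simp_all add: assms)

lemma nat_ceiling_half: "nat \<lceil>real n / 2\<rceil> = (n + 1) div 2"
proof (cases "even n")
  case True
  then obtain k where "n = 2 * k" by (rule evenE)
  then show ?thesis by simp
next
  case False
  then obtain k where "n = 2 * k + 1" by (rule oddE)
  then have "\<lceil>real n / 2\<rceil> = int k + 1" by (intro ceiling_unique) auto
  then show ?thesis using \<open>n = 2 * k + 1\<close> by simp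
qed

theorem theorem5p2:
  fixes n :: nat
  assumes "n \<ge> 1"
  shows "burning_game_number (hypercube n) =
           (if n \<in> {1, 2} then 2 else nat \<lceil>(real n + 1) / 2\<rceil> + 1)
       \<and> staller_start_burning_game_number (hypercube n) = nat \<lceil>real n / 2\<rceil> + 1"
proof
  have lower: "rounds_left (hypercube n) p {} > (n + 1) div 2" for p
    by (rule hypercube_game_gt_half)
  have "rounds_left (hypercube n) Burner {v} \<le> Suc ((n + 1) div 2 - 1)" if "length v = n" for v
    using that by (intro hypercube_antipode_le[of v]) auto
  then have "rounds_left (hypercube n) Staller {} \<le> Suc ((n + 1) div 2)"
    using assms by (intro rounds_left_Staller_le) simp_all
  then show "staller_start_burning_game_number (hypercube n) = nat \<lceil>real n / 2\<rceil> + 1"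
    using lower[of Staller]
    by (simp add: staller_start_burning_game_number_def nat_ceiling_half)
  have half: "nat \<lceil>(real n + 1) / 2\<rceil> = n div 2 + 1"
    using nat_ceiling_half[of "n + 1"] by (simp add: add.commute)
  show "burning_game_number (hypercube n) =
      (if n \<in> {1, 2} then 2 else nat \<lceil>(real n + 1) / 2\<rceil> + 1)"
  proof (cases "n \<le> 2")
    case True
    then have "rounds_left (hypercube n) Burner {} \<le> Suc 1"
      by (intro hypercube_Burner_start_le hypercube_dim_le_2_Staller_le)
    moreover have "n = 1 \<or> n = 2" using True assms by linarith
    ultimately show ?thesis
      using lower[of Burner] by (auto simp: burning_game_number_def)
  next
    case False
    have "rounds_left (hypercube n) Burner {} \<le> Suc (Suc (Suc (n div 2 - 1)))"
      using False by (intro hypercube_Burner_start_le hypercube_delayed_antipode_le) simp_all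
    moreover have "rounds_left (hypercube n) Burner {} > n div 2 + 1"
    \<comment> \<open>For odd \<open>n\<close> the general bound \<open>(n + 1) div 2\<close> equals
      \<open>n div 2 + 1\<close>; for even \<open>n\<close> it is one less, and Staller's reply at
      distance 2 makes up for it.\<close>
    proof (cases "even n")
      case True
      then show ?thesis using hypercube_even_Burner_gt[of n "n div 2"] False by fastforce
    next
      case odd: False
      then show ?thesis using lower[of Burner] by simp
    qed
    ultimately show ?thesis
      using False by (simp add: burning_game_number_def half)
  qed
qed

end
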